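(* Let $\mathfrak{g}=2\mathfrak{g}_{2.1}$ be the four-dimensional real Lie algebra with basis $\mathcal{B}=\{e_1,e_2,e_3,e_4\}$ whose nonzero Lie brackets (up to skew-symmetry) are $[e_1,e_2]=e_1$, $[e_3,e_4]=e_3$. Let $\langle\cdot,\cdot\rangle$ be a pseudo-Riemannian inner product on $\mathfrak{g}$ and let $(R_{ij})$ be the matrix of its Ricci operator $\operatorname{Ric}$ in the basis $\mathcal{B}$. If $$R_{i1}=0\ (i=2,3,4),\quad R_{i3}=0\ (i=1,2,4),\quad R_{32}=R_{42}=R_{14}=R_{24}=0,\quad R_{22}=R_{44},$$ then $\langle\cdot,\cdot\rangle$ is an algebraic Ricci soliton. With these relations in place, $\operatorname{Ric}=\eta I_4+D$ where $\eta=R_{22}$ and $$D=\begin{bmatrix}R_{11}-R_{22}&R_{12}&0&0\\0&0&0&0\\0&0&R_{33}-R_{22}&R_{34}\\0&0&0&0\end{bmatrix}$$ is (the matrix in the basis $\mathcal{B}$ of) a derivation of $\mathfrak{g}$.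
   Context: A pseudo-Riemannian inner product on a real Lie algebra $\mathfrak{g}$ is a nondegenerate symmetric bilinear form $\langle\cdot,\cdot\rangle$ on $\mathfrak{g}$ (of some signature $(r,s)$). Its Levi-Civita connection $\nabla$ is defined by $2\langle\nabla_uv,w\rangle=\langle[u,v],w\rangle+\langle[w,u],v\rangle+\langle[w,v],u\rangle$; its curvature is $R_{uv}=\nabla_{[u,v]}-[\nabla_u,\nabla_v]$; its Ricci curvature $\operatorname{ric}(u,v)$ is the trace of $w\mapsto R_{uw}v$; its Ricci operator $\operatorname{Ric}$ is the endomorphism of $\mathfrak{g}$ with $\langle\operatorname{Ric}(u),v\rangle=\operatorname{ric}(u,v)$. The matrix $(R_{ij})$ of $\operatorname{Ric}$ in a basis $\{e_i\}$ is given by $\operatorname{Ric}(e_j)=\sum_iR_{ij}e_i$ (the same column convention is used for $D$). A derivation is a linear map $D:\mathfrak{g}\to\mathfrak{g}$ with $D[x,y]=[D(x),y]+[x,D(y)]$ for all $x,y$. The inner product is an algebraic Ricci soliton if $\operatorname{Ric}=\eta\,\mathrm{Id}_{\mathfrak{g}}+D$ for some $\eta\in\mathbb{R}$ and some derivation $D$ of $\mathfrak{g}$. *)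

theory Defs
  imports "HOL-Analysis.Analysis"
begin

definition lie_bracket :: "('a::real_vector \<Rightarrow> 'a \<Rightarrow> 'a) \<Rightarrow> bool" where
  "lie_bracket br \<longleftrightarrow>
     bilinear br \<and> (\<forall>x. br x x = 0) \<and>
     (\<forall>x y z. br x (br y z) + br y (br z x) + br z (br x y) = 0)"

definition derivation :: "('a::real_vector \<Rightarrow> 'a \<Rightarrow> 'a) \<Rightarrow> ('a \<Rightarrow> 'a) \<Rightarrow> bool" where
  "derivation br D \<longleftrightarrow> linear D \<and> (\<forall>x y. D (br x y) = br (D x) y + br x (D y))"

text \<open>The form may have any signature.\<close>

definition pseudo_inner_product :: "('a::real_vector \<Rightarrow> 'a \<Rightarrow> real) \<Rightarrow> bool" where
  "pseudo_inner_product g \<longleftrightarrow>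
     bilinear g \<and> (\<forall>x y. g x y = g y x) \<and> (\<forall>x. (\<forall>y. g x y = 0) \<longrightarrow> x = 0)"

text \<open>\<open>levi_civita br g u v\<close> is \<open>\<nabla>\<^sub>u v\<close>, given by the Koszul formula;
  \<open>levi_civita_eq\<close> below shows that the description is well defined.\<close>

definition levi_civita ::
    "('a::real_vector \<Rightarrow> 'a \<Rightarrow> 'a) \<Rightarrow> ('a \<Rightarrow> 'a \<Rightarrow> real) \<Rightarrow> 'a \<Rightarrow> 'a \<Rightarrow> 'a" where
  "levi_civita br g u v =
     (THE z. \<forall>w. 2 * g z w = g (br u v) w + g (br w u) v + g (br w v) u)"

text \<open>Sign convention: \<open>R\<^sub>u\<^sub>v = \<nabla>\<^bsub>[u,v]\<^esub> - [\<nabla>\<^sub>u, \<nabla>\<^sub>v]\<close>.\<close>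

definition curvature ::
    "('a::real_vector \<Rightarrow> 'a \<Rightarrow> 'a) \<Rightarrow> ('a \<Rightarrow> 'a \<Rightarrow> real) \<Rightarrow> 'a \<Rightarrow> 'a \<Rightarrow> 'a \<Rightarrow> 'a" where
  "curvature br g u v x =
     levi_civita br g (br u v) x
       - (levi_civita br g u (levi_civita br g v x) - levi_civita br g v (levi_civita br g u x))"

definition ricci_curvature ::
    "(real^'n \<Rightarrow> real^'n \<Rightarrow> real^'n) \<Rightarrow> (real^'n \<Rightarrow> real^'n \<Rightarrow> real) \<Rightarrow> real^'n \<Rightarrow> real^'n \<Rightarrow> real" where
  "ricci_curvature br g u v = trace (matrix (\<lambda>w. curvature br g u w v))"

definition ricci_operator ::
    "(real^'n \<Rightarrow> real^'n \<Rightarrow> real^'n) \<Rightarrow> (real^'n \<Rightarrow> real^'n \<Rightarrow> real) \<Rightarrow> real^'n \<Rightarrow> real^'n" where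
  "ricci_operator br g =
     (THE f. linear f \<and> (\<forall>u v. g (f u) v = ricci_curvature br g u v))"

definition algebraic_ricci_soliton ::
    "(real^'n \<Rightarrow> real^'n \<Rightarrow> real^'n) \<Rightarrow> (real^'n \<Rightarrow> real^'n \<Rightarrow> real) \<Rightarrow> bool" where
  "algebraic_ricci_soliton br g \<longleftrightarrow>
     (\<exists>\<eta> D. derivation br D \<and> ricci_operator br g = (\<lambda>x. \<eta> *\<^sub>R x + D x))"

text \<open>The Lie algebra \<open>2\<gg>\<^bsub>2.1\<^esub>\<close>, modelled on \<open>real^4\<close> with \<open>e\<^sub>i = axis i 1\<close>:
  the bilinear alternating extension of \<open>[e\<^sub>1,e\<^sub>2] = e\<^sub>1\<close>, \<open>[e\<^sub>3,e\<^sub>4] = e\<^sub>3\<close>, all other brackets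
  of basis vectors being zero (see \<open>lie_2g21_basis\<close>).\<close>

definition lie_2g21 :: "real^4 \<Rightarrow> real^4 \<Rightarrow> real^4" where
  "lie_2g21 x y = (x$1 * y$2 - x$2 * y$1) *\<^sub>R axis 1 1 + (x$3 * y$4 - x$4 * y$3) *\<^sub>R axis 3 1"

lemma lie_2g21_basis:
  "lie_2g21 (axis 1 1) (axis 2 1) = axis 1 1"
  "lie_2g21 (axis 3 1) (axis 4 1) = axis 3 1"
  "lie_2g21 (axis 1 1) (axis 3 1) = 0"
  "lie_2g21 (axis 1 1) (axis 4 1) = 0"
  "lie_2g21 (axis 2 1) (axis 3 1) = 0"
  "lie_2g21 (axis 2 1) (axis 4 1) = 0"
  by (simp_all add: lie_2g21_def axis_def)

lemma lie_bracket_lie_2g21: "lie_bracket lie_2g21"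
  unfolding lie_bracket_def bilinear_def linear_iff lie_2g21_def
  by (simp add: vec_eq_iff forall_4 axis_def algebra_simps)

lemma vector_4:
  "(vector [a, b, c, d] :: 'a::zero^4) $ 1 = a"
  "(vector [a, b, c, d] :: 'a^4) $ 2 = b"
  "(vector [a, b, c, d] :: 'a^4) $ 3 = c"
  "(vector [a, b, c, d] :: 'a^4) $ 4 = d"
  by (simp_all add: vector_def)

lemma pseudo_inner_product_cancel:
  assumes "pseudo_inner_product g" "\<And>w. g x w = g y w"
  shows "x = y"
proof -
  have "g (x - y) w = 0" for w
    using bilinear_lsub[of g x y w] assms(2)[of w] assms(1)
    unfolding pseudo_inner_product_def by linarith
  then show ?thesis using assms(1) unfolding pseudo_inner_product_def by force
qed

lemma pseudo_inner_product_representation: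
  fixes g :: "'a::euclidean_space \<Rightarrow> 'a \<Rightarrow> real"
  assumes g: "pseudo_inner_product g" and \<phi>: "linear \<phi>"
  shows "\<exists>z. \<forall>w. g z w = \<phi> w"
proof -
  have bil: "bilinear g" using g by (simp add: pseudo_inner_product_def)
  define F where "F z = (\<Sum>b\<in>Basis. g z b *\<^sub>R b)" for z
  have F_inner: "F z \<bullet> b = g z b" if "b \<in> Basis" for z b
    using that by (simp add: F_def inner_sum_left inner_Basis if_distrib cong: if_cong)
  have linF: "linear F"
    unfolding F_def using bil
    by (intro linearI)
       (simp_all add: bilinear_ladd bilinear_lmul scaleR_add_left sum.distrib scaleR_sum_right)
  have ext: "g z w = \<psi> w" if "linear \<psi>" "\<And>b. b \<in> Basis \<Longrightarrow> g z b = \<psi> b" for z w \<psi>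
    using linear_eq_stdbasis[of "g z" \<psi>] bil that by (auto simp: bilinear_def)
  have "inj F"
  proof (rule injI)
    fix x y assume "F x = F y"
    then have "g x b = g y b" if "b \<in> Basis" for b
      using F_inner[OF that, of x] F_inner[OF that, of y] by simp
    then have "g x w = g y w" for w
      using ext[of "g y" x w] bil by (auto simp: bilinear_def)
    then show "x = y" by (rule pseudo_inner_product_cancel[OF g])
  qed
  then have "surj F" using linear_injective_imp_surjective linF by blast
  then obtain z where "F z = (\<Sum>b\<in>Basis. \<phi> b *\<^sub>R b)" by (metis surjD)
  then have "g z b = \<phi> b" if "b \<in> Basis" for b
    using F_inner[OF that, of z] that
    by (simp add: inner_sum_left inner_Basis if_distrib cong: if_cong)
  then show ?thesis using ext[OF \<phi>] by blast
qed

lemma levi_civita_eq: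
  fixes g :: "'a::euclidean_space \<Rightarrow> 'a \<Rightarrow> real"
  assumes g: "pseudo_inner_product g" and br: "bilinear br"
  shows "2 * g (levi_civita br g u v) w = g (br u v) w + g (br w u) v + g (br w v) u"
proof -
  have bil: "bilinear g" using g by (simp add: pseudo_inner_product_def)
  have "linear (\<lambda>w. (g (br u v) w + g (br w u) v + g (br w v) u) / 2)"
    using bil br
    by (intro linearI)
       (simp_all add: bilinear_ladd bilinear_radd bilinear_lmul bilinear_rmul field_simps)
  from pseudo_inner_product_representation[OF g this] obtain z where
    z: "\<forall>w. 2 * g z w = g (br u v) w + g (br w u) v + g (br w v) u"
    by (auto simp: mult.commute)
  have "y = z" if "\<forall>w. 2 * g y w = g (br u v) w + g (br w u) v + g (br w v) u" for y
    using that z by (intro pseudo_inner_product_cancel[OF g]) (metis mult_left_cancel zero_neq_numeral)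
  with z show ?thesis
    unfolding levi_civita_def by (rule theI2[where a = z]) auto
qed

lemma bilinear_levi_civita:
  fixes g :: "'a::euclidean_space \<Rightarrow> 'a \<Rightarrow> real"
  assumes g: "pseudo_inner_product g" and br: "bilinear br"
  shows "bilinear (levi_civita br g)"
proof -
  have bil: "bilinear g" using g by (simp add: pseudo_inner_product_def)
  note lin = bilinear_ladd bilinear_radd bilinear_lmul bilinear_rmul
  note K = levi_civita_eq[OF g br]
  have canc: "x = y" if "\<And>w. 2 * g x w = 2 * g y w" for x y
    using that by (intro pseudo_inner_product_cancel[OF g]) simp
  have "2 * g (levi_civita br g x (y + z)) w = 2 * g (levi_civita br g x y + levi_civita br g x z) w"
    and "2 * g (levi_civita br g (x + y) z) w = 2 * g (levi_civita br g x z + levi_civita br g y z) w"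
    for x y z w
    unfolding lin(1)[OF bil] distrib_left K by (simp_all add: lin[OF bil] lin[OF br])
  moreover have "2 * g (levi_civita br g x (c *\<^sub>R y)) w = c * (2 * g (levi_civita br g x y) w)"
    and "2 * g (levi_civita br g (c *\<^sub>R x) y) w = c * (2 * g (levi_civita br g x y) w)"
    for x y w c
    unfolding K by (simp_all add: lin[OF bil] lin[OF br] distrib_left)
  ultimately show ?thesis
    unfolding bilinear_def linear_iff
    by (intro conjI allI canc) (simp_all add: lin[OF bil])
qed

lemma ricci_operator:
  fixes g :: "real^'n \<Rightarrow> real^'n \<Rightarrow> real"
  assumes g: "pseudo_inner_product g" and br: "bilinear br"
  shows "linear (ricci_operator br g)"
    and "g (ricci_operator br g u) v = ricci_curvature br g u v"
proof -
  have bil: "bilinear g" using g by (simp add: pseudo_inner_product_def)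
  note lin = bilinear_ladd bilinear_radd bilinear_lmul bilinear_rmul
  note L = bilinear_levi_civita[OF g br]
  let ?r = "ricci_curvature br g"
  have bilr: "bilinear ?r"
    unfolding bilinear_def linear_iff ricci_curvature_def curvature_def trace_def matrix_def
    by (simp add: lin[OF L] lin[OF br] scaleR_diff_right sum.distrib sum_subtractf
          right_diff_distrib flip: sum_distrib_left)
  then have "\<exists>z. \<forall>v. g z v = ?r u v" for u
    using pseudo_inner_product_representation[OF g] by (simp add: bilinear_def)
  then obtain f where f: "\<And>u v. g (f u) v = ?r u v" by metis
  have "linear f"
    by (intro linearI pseudo_inner_product_cancel[OF g])
       (simp_all add: lin[OF bil] f lin[OF bilr])
  moreover have "h = f" if "\<forall>u v. g (h u) v = ?r u v" for h
  proof
    fix u show "h u = f u"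
      by (rule pseudo_inner_product_cancel[OF g]) (simp only: that f)
  qed
  ultimately have "\<exists>!f. linear f \<and> (\<forall>u v. g (f u) v = ?r u v)"
    using f by blast
  from theI'[OF this] have "linear (ricci_operator br g) \<and> (\<forall>u v. g (ricci_operator br g u) v = ?r u v)"
    unfolding ricci_operator_def .
  then show "linear (ricci_operator br g)" "g (ricci_operator br g u) v = ?r u v" by blast+
qed

end

theory Submission
  imports Defs
begin

text \<open>This is linear algebra once Ric is known to be linear. The vanishing entries and
  \<open>R$2$2 = R$4$4\<close> say exactly that \<open>R\<close> minus \<open>R$2$2\<close> times
  the identity is \<open>D\<close>. This \<open>D\<close> is an inner derivation, the bracket with
  R12 e1 - (R11 - R22) e2 + R34 e3 - (R33 - R22) e4 in the first slot.\<close>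

theorem theorem3p2:
  fixes g :: "real^4 \<Rightarrow> real^4 \<Rightarrow> real" and R D :: "real^4^4"
  assumes "pseudo_inner_product g"
    and "R = matrix (ricci_operator lie_2g21 g)"
    and "R$2$1 = 0" "R$3$1 = 0" "R$4$1 = 0"
    and "R$1$3 = 0" "R$2$3 = 0" "R$4$3 = 0"
    and "R$3$2 = 0" "R$4$2 = 0" "R$1$4 = 0" "R$2$4 = 0"
    and "R$2$2 = R$4$4"
    and "D = vector [vector [R$1$1 - R$2$2, R$1$2, 0, 0],
                     vector [0, 0, 0, 0],
                     vector [0, 0, R$3$3 - R$2$2, R$3$4],
                     vector [0, 0, 0, 0]]"
  shows "algebraic_ricci_soliton lie_2g21 g
       \<and> R = (R$2$2) *\<^sub>R mat 1 + D
       \<and> ricci_operator lie_2g21 g = (\<lambda>x. (R$2$2) *\<^sub>R x + D *v x)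
       \<and> derivation lie_2g21 (\<lambda>x. D *v x)"
proof -
  have R: "R = R$2$2 *\<^sub>R mat 1 + D"
    using assms(3-) by (simp add: vec_eq_iff forall_4 mat_def vector_4)
  have bil: "bilinear lie_2g21"
    using lie_bracket_lie_2g21 by (simp add: lie_bracket_def)
  \<comment> \<open>The matrix determines Ric because Ric is linear, which rests on bilinearity of
    ric and nondegeneracy of \<open>g\<close>.\<close>
  have "ricci_operator lie_2g21 g x = R *v x" for x
    unfolding assms(2) by (simp add: matrix_works ricci_operator(1)[OF assms(1) bil])
  also have "R *v x = (R$2$2) *\<^sub>R x + D *v x" for x
    by (subst R) (simp add: matrix_vector_mult_add_rdistrib flip: scaleR_matrix_vector_assoc)
  finally have ric: "ricci_operator lie_2g21 g = (\<lambda>x. (R$2$2) *\<^sub>R x + D *v x)"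
    by (rule ext)
  \<comment> \<open>Checked in coordinates: \<open>D\<close> and all brackets take values in
    span(e1, e3), so coordinates 2 and 4 vanish; in coordinates 1 and 3 the terms with R12 and R34
    cancel.\<close>
  have der: "derivation lie_2g21 (\<lambda>x. D *v x)"
    unfolding derivation_def assms(14) lie_2g21_def
    by (simp add: vec_eq_iff forall_4 matrix_vector_mult_def sum_4 vector_4 axis_def algebra_simps)
  show ?thesis
    using R ric der unfolding algebraic_ricci_soliton_def by blast
qed

end
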